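(* Let $n \geq 3$ be an integer and let $\Phi_n(x)$ be the $n$th cyclotomic polynomial, which has even degree $\phi(n)$. Let $c_n$ denote the middle coefficient of $\Phi_n(x)$, i.e. the coefficient of $x^{\phi(n)/2}$ in $\Phi_n(x)$. If $n$ is a power of $2$, then $c_n = 0$; if $n$ is not a power of $2$, then $c_n$ is an odd integer.
   Context: $\phi$ is Euler's totient function. For a positive integer $n$, the $n$th cyclotomic polynomial is $\Phi_n(x) = \prod_{1 \le k \le n,\ \gcd(k,n)=1} \left(x - e^{2\pi i k/n}\right)$, a monic polynomial with integer coefficients of degree $\phi(n)$. For $n \geq 3$, $\phi(n)$ is even, and the middle coefficient of $\Phi_n(x)$ means the coefficient of $x^{\phi(n)/2}$. *)

theory Defs
  imports
    "HOL-Analysis.Analysis"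
    "HOL-Computational_Algebra.Polynomial"
    "HOL-Number_Theory.Totient"
begin

definition cyclotomic :: "nat \<Rightarrow> complex poly" where
  "cyclotomic n =
    (\<Prod>k | 1 \<le> k \<and> k \<le> n \<and> coprime k n.
      [: - exp (2 * of_real pi * \<i> * of_nat k / of_nat n), 1 :])"

end

(* The polynomial Phi_n has integer coefficients and is self-reciprocal up to a sign, so modulo 2
   all coefficients other than the middle one cancel in pairs in Phi_n(1); hence the middle
   coefficient has the parity of Phi_n(1). Write n = 2^a m with m odd. Dividing
   x^n - 1 by x^(2^a) - 1 shows that the product of Phi_d over the divisors d of n that do not
   divide 2^a is the sum of x^(2^a i) for i < m, which takes the odd value m at 1. If m > 1, then
   Phi_n is one of these factors, so Phi_n(1) is odd. If m = 1, the analogous quotient gives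
   Phi_n = x^(n/2) + 1. *)
theory Submission
  imports Defs
begin

section \<open>Degree, constant term and symmetry of \<open>cyclotomic n\<close>\<close>

lemma cyclotomic_altdef:
  "cyclotomic n = (\<Prod>k\<in>totatives n. [:- cis (2 * pi * real k / real n), 1:])"
proof -
  have "{k. 1 \<le> k \<and> k \<le> n \<and> coprime k n} = totatives n"
    by (auto simp: totatives_def)
  moreover have "exp (2 * of_real pi * \<i> * of_nat k / of_nat n) = cis (2 * pi * real k / real n)" for k
    by (simp add: cis_conv_exp mult_ac)
  ultimately show ?thesis
    by (simp add: cyclotomic_def)
qed

lemma degree_cyclotomic: "degree (cyclotomic n) = totient n"
  by (simp add: cyclotomic_altdef degree_prod_sum_eq totient_def)

text \<open>The constant term is a product of negated roots of unity. Together with integrality this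
  makes it 1 or -1.\<close>

lemma norm_coeff_0_cyclotomic: "norm (coeff (cyclotomic n) 0) = 1"
  by (simp add: cyclotomic_altdef flip: poly_0_coeff_0) (simp add: poly_prod flip: prod_norm)

lemma bij_betw_totatives_minus:
  assumes "n \<ge> 2"
  shows "bij_betw (\<lambda>k. n - k) (totatives n) (totatives n)"
proof (rule bij_betw_byWitness[where f' = "\<lambda>k. n - k"])
  show "(\<lambda>k. n - k) ` totatives n \<subseteq> totatives n"
  proof (intro image_subsetI)
    fix k assume k: "k \<in> totatives n"
    then have "k < n"
      using assms by (simp add: totatives_less)
    moreover from this have "gcd (n - k) n = gcd k n"
      by (simp add: gcd_diff2_nat)
    ultimately show "n - k \<in> totatives n"
      using k by (simp add: in_totatives_iff coprime_iff_gcd_eq_1)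
  qed
  then show "(\<lambda>k. n - k) ` totatives n \<subseteq> totatives n" .
qed (simp_all add: in_totatives_iff)

text \<open>The involution \<open>k \<mapsto> n - k\<close> pairs the totatives below
  \<open>n / 2\<close> with those above. It has no fixed point: \<open>2 * k = n\<close> with
  \<open>k\<close> coprime to \<open>n\<close> forces \<open>k = 1\<close>, hence
  \<open>n = 2\<close>.\<close>

lemma even_totient:
  assumes "n \<ge> 3"
  shows "even (totient n)"
proof -
  define L U where "L = {k\<in>totatives n. 2 * k < n}" and "U = {k\<in>totatives n. 2 * k > n}"
  have "2 * k \<noteq> n" if "k \<in> totatives n" for k
  proof
    assume "2 * k = n"
    with that have "k = 1"
      by (auto simp: in_totatives_iff)
    with \<open>2 * k = n\<close> assms show False
      by simp
  qed
  then have "totatives n = L \<union> U"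
    by (force simp: L_def U_def)
  moreover have "bij_betw (\<lambda>k. n - k) L U"
    unfolding bij_betw_def
  proof
    have bij: "bij_betw (\<lambda>k. n - k) (totatives n) (totatives n)"
      using assms by (intro bij_betw_totatives_minus) auto
    show "inj_on (\<lambda>k. n - k) L"
      using bij by (auto simp: bij_betw_def L_def intro: inj_on_subset)
    show "(\<lambda>k. n - k) ` L = U"
    proof (intro equalityI subsetI)
      fix l assume "l \<in> (\<lambda>k. n - k) ` L"
      then show "l \<in> U"
        using bij by (auto simp: L_def U_def dest: bij_betwE)
    next
      fix l assume l: "l \<in> U"
      then obtain k where "k \<in> totatives n" "l = n - k"
        using bij by (auto simp: U_def bij_betw_def)
      with l show "l \<in> (\<lambda>k. n - k) ` L"
        by (auto simp: L_def U_def in_totatives_iff)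
    qed
  qed
  then have "card L = card U"
    by (rule bij_betw_same_card)
  moreover have "L \<inter> U = {}" "finite L" "finite U"
    by (auto simp: L_def U_def)
  ultimately show ?thesis
    by (simp add: totient_def card_Un_disjoint)
qed

text \<open>Reversing the coefficients inverts the roots, and inversion permutes the primitive
  \<open>n\<close>-th roots of unity through \<open>k \<mapsto> n - k\<close>.\<close>

lemma reflect_cyclotomic:
  assumes "n \<ge> 2"
  shows "reflect_poly (cyclotomic n) = smult (coeff (cyclotomic n) 0) (cyclotomic n)"
proof -
  let ?w = "\<lambda>k. cis (2 * pi * real k / real n)"
  have inv: "?w (n - k) * ?w k = 1" if "k \<in> totatives n" for k
  proof -
    have "2 * pi * real (n - k) / real n + 2 * pi * real k / real n = 2 * pi"
      using that assms by (simp add: in_totatives_iff of_nat_diff field_simps)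
    then show ?thesis
      by (simp add: cis_mult)
  qed
  have "reflect_poly (cyclotomic n) = (\<Prod>k\<in>totatives n. [:1, - ?w k:])"
    by (simp add: cyclotomic_altdef reflect_poly_prod reflect_poly_pCons cong: prod.cong)
  \<comment> \<open>Each factor is rewritten as 1 - w x = -w (x - 1/w), where 1/w is the root with
    index \<open>n - k\<close>.\<close>
  also have "\<dots> = (\<Prod>k\<in>totatives n. [:- ?w k:] * [:- ?w (n - k), 1:])"
    by (intro prod.cong refl) (simp add: inv)
  also have "\<dots> = (\<Prod>k\<in>totatives n. [:- ?w k:]) * (\<Prod>k\<in>totatives n. [:- ?w (n - k), 1:])"
    by (rule prod.distrib)
  also have "(\<Prod>k\<in>totatives n. [:- ?w (n - k), 1:]) = cyclotomic n"
    unfolding cyclotomic_altdef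
    by (rule prod.reindex_bij_betw[OF bij_betw_totatives_minus[OF assms]])
  also have "(\<Prod>k\<in>totatives n. [:- ?w k:]) = [:\<Prod>k\<in>totatives n. - ?w k:]"
    by (rule prod_to_poly)
  also have "(\<Prod>k\<in>totatives n. - ?w k) = coeff (cyclotomic n) 0"
    by (simp add: cyclotomic_altdef poly_prod flip: poly_0_coeff_0)
  finally show ?thesis
    by simp
qed

section \<open>Factorization of x^n - 1\<close>

text \<open>Both sides have degree at most \<open>n\<close> and the same coefficient at x^n, so
  agreement at the \<open>n\<close> roots of unity forces equality.\<close>

lemma prod_roots_of_unity:
  assumes "n > 0"
  shows "(\<Prod>k\<in>{0<..n}. [:- cis (2 * pi * real k / real n), 1:]) = monom 1 n - 1"
    (is "?p = _")
proof (rule poly_eqI_degree_lead_coeff)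
  have deg: "degree ?p = n"
    by (simp add: degree_prod_sum_eq)
  have "lead_coeff ?p = 1"
    by (simp add: lead_coeff_prod)
  with deg assms show "coeff ?p n = coeff (monom 1 n - 1) n"
    by simp
  show "degree ?p \<le> n"
    by (simp add: deg)
  show "degree (monom (1 :: complex) n - 1) \<le> n"
    by (intro degree_diff_le) (auto simp: degree_monom_le)
  show "card {z :: complex. z ^ n = 1} \<ge> n"
    using assms by (simp add: card_roots_unity_eq)
  fix z :: complex
  assume z: "z \<in> {z. z ^ n = 1}"
  then obtain k where k: "k < n" "z = cis (2 * pi * real k / real n)"
    using Complex.bij_betw_roots_unity[OF assms] by (auto simp: bij_betw_def)
  \<comment> \<open>The roots come indexed from 0 to \<open>n - 1\<close>, the product from 1 to
    \<open>n\<close>; indices 0 and \<open>n\<close> both give the root 1.\<close>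
  have "\<exists>k\<in>{0<..n}. z = cis (2 * pi * real k / real n)"
    using k assms by (intro bexI[of _ "if k = 0 then n else k"]) auto
  then have "poly ?p z = 0"
    by (auto simp: poly_prod)
  then show "poly ?p z = poly (monom 1 n - 1) z"
    using z by (simp add: poly_monom)
qed

text \<open>The roots are grouped by \<open>d = gcd k n\<close>: in lowest terms
  \<open>k / n\<close> has denominator \<open>n div d\<close>, so each group consists of the
  primitive roots of that order.\<close>

lemma prod_cyclotomic:
  assumes "n > 0"
  shows "(\<Prod>d | d dvd n. cyclotomic d) = monom 1 n - 1"
proof -
  let ?f = "\<lambda>n k. [:- cis (2 * pi * real k / real n), 1:]"
  have "monom 1 n - 1 = (\<Prod>k\<in>{0<..n}. ?f n k)"
    using prod_roots_of_unity[OF assms] by simp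
  also have "\<dots> = (\<Prod>d | d dvd n. \<Prod>k | k \<in> {0<..n} \<and> gcd k n = d. ?f n k)"
    using assms by (intro prod.group[symmetric]) auto
  also have "\<dots> = (\<Prod>d | d dvd n. cyclotomic (n div d))"
  proof (intro prod.cong refl)
    fix d assume "d \<in> {d. d dvd n}"
    then have d: "d dvd n" "d > 0"
      using assms by (auto intro: Nat.gr0I)
    have "(\<Prod>k | k \<in> {0<..n} \<and> gcd k n = d. ?f n k) = (\<Prod>k\<in>totatives (n div d). ?f n (k * d))"
      by (rule prod.reindex_bij_betw[OF bij_betw_totatives_gcd_eq[OF d(1) assms], symmetric])
    also have "\<dots> = cyclotomic (n div d)"
      using d assms by (simp add: cyclotomic_altdef real_of_nat_div mult.assoc)
    finally show "(\<Prod>k | k \<in> {0<..n} \<and> gcd k n = d. ?f n k) = cyclotomic (n div d)" .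
  qed
  also have "\<dots> = (\<Prod>d | d dvd n. cyclotomic d)"
    using assms by (intro prod.reindex_bij_witness[of _ "\<lambda>d. n div d" "\<lambda>d. n div d"]) auto
  finally show ?thesis
    by simp
qed

section \<open>Integrality of the coefficients\<close>

text \<open>Solving for the coefficients of \<open>q\<close> from the bottom up, one only divides by
  the unit \<open>coeff p 0\<close>.\<close>

lemma coeff_Ints_of_mult:
  fixes p q :: "'a :: comm_ring_1 poly"
  assumes unit: "coeff p 0 \<in> {1, -1}"
    and p: "\<And>i. coeff p i \<in> \<int>" and pq: "\<And>i. coeff (p * q) i \<in> \<int>"
  shows "coeff q i \<in> \<int>"
proof (induction i rule: less_induct)
  case (less i)
  have "coeff (p * q) i = coeff p 0 * coeff q i + (\<Sum>j\<in>{0<..i}. coeff p j * coeff q (i - j))"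
    by (simp add: coeff_mult sum.head flip: atLeast0AtMost)
  then have "coeff p 0 * coeff q i = coeff (p * q) i - (\<Sum>j\<in>{0<..i}. coeff p j * coeff q (i - j))"
    by simp
  also have "\<dots> \<in> \<int>"
    by (intro Ints_diff pq Ints_sum Ints_mult p less.IH) auto
  finally show ?case
    using unit Ints_minus[of "- coeff q i"] by auto
qed

lemma Ints_norm_1:
  fixes z :: complex
  assumes "z \<in> \<int>" "norm z = 1"
  shows "z \<in> {1, -1}"
proof -
  obtain k where k: "z = of_int k"
    using assms(1) by (elim Ints_cases)
  with assms(2) have "\<bar>k\<bar> = 1"
    by (simp flip: of_int_abs)
  then show ?thesis
    using k by (auto simp: abs_if split: if_splits)
qed

lemma coeff_prod_Ints:
  assumes "\<And>x i. x \<in> A \<Longrightarrow> coeff (f x) i \<in> \<int>"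
  shows "coeff (prod f A) i \<in> \<int>"
  using assms
  by (induction A arbitrary: i rule: infinite_finite_induct)
     (auto intro!: coeff_mult_semiring_closed simp: coeff_1)

text \<open>Strong induction: the product \<open>p\<close> over the proper divisors has integer
  coefficients, and its constant term is an integer of modulus 1, hence a unit. Dividing x^n - 1 by
  \<open>p\<close> therefore stays within the integers.\<close>

lemma coeff_cyclotomic_Ints: "coeff (cyclotomic n) i \<in> \<int>"
proof (induction n arbitrary: i rule: less_induct)
  case (less n)
  show ?case
  proof (cases "n = 0")
    case True
    then show ?thesis
      by (simp add: cyclotomic_altdef coeff_1)
  next
    case False
    define p where "p = (\<Prod>d | d dvd n \<and> d \<noteq> n. cyclotomic d)"
    have p_Ints: "coeff p i \<in> \<int>" for i
      unfolding p_def using False by (intro coeff_prod_Ints less.IH) (auto dest: dvd_imp_le)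
    have "p * cyclotomic n = (\<Prod>d\<in>insert n {d. d dvd n \<and> d \<noteq> n}. cyclotomic d)"
      using False by (simp add: p_def mult.commute)
    also have "insert n {d. d dvd n \<and> d \<noteq> n} = {d. d dvd n}"
      by auto
    also have "(\<Prod>d | d dvd n. cyclotomic d) = monom 1 n - 1"
      using False by (intro prod_cyclotomic) auto
    finally have eq: "p * cyclotomic n = monom 1 n - 1" .
    have "norm (coeff p 0) = 1"
      by (simp add: p_def poly_prod norm_coeff_0_cyclotomic[unfolded poly_0_coeff_0[symmetric]]
          flip: poly_0_coeff_0 prod_norm)
    then have "coeff p 0 \<in> {1, -1}"
      by (intro Ints_norm_1 p_Ints)
    moreover have "coeff (p * cyclotomic n) i \<in> \<int>" for i
      by (simp add: eq coeff_1)
    ultimately show ?thesis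
      using p_Ints by (metis coeff_Ints_of_mult)
  qed
qed

lemma cyclotomic_int_coeffs:
  obtains c :: "nat \<Rightarrow> int" where "\<And>i. coeff (cyclotomic n) i = of_int (c i)"
  using coeff_cyclotomic_Ints[of n] unfolding Ints_def image_iff by metis

section \<open>Parity of the middle coefficient\<close>

lemma odd_middle_coeff_cyclotomic_iff:
  assumes n: "n \<ge> 3" and c: "\<And>i. coeff (cyclotomic n) i = of_int (c i)"
    and v: "poly (cyclotomic n) 1 = of_int v"
  shows "odd (c (totient n div 2)) \<longleftrightarrow> odd v"
proof -
  define m where "m = totient n div 2"
  have m: "totient n = 2 * m"
    using even_totient[OF n] by (simp add: m_def)
  have unit: "c 0 \<in> {1, -1}"
    using norm_coeff_0_cyclotomic[of n] by (auto simp: c abs_if split: if_splits)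
  \<comment> \<open>Self-reciprocity gives \<open>c (2 * m - i) = c 0 * c i\<close>, and the factor
    \<open>c 0\<close> is a sign, which does not affect parity.\<close>
  have sym: "even (c (2 * m - i)) \<longleftrightarrow> even (c i)" if "i \<le> 2 * m" for i
  proof -
    have "coeff (reflect_poly (cyclotomic n)) i = coeff (smult (coeff (cyclotomic n) 0) (cyclotomic n)) i"
      using n by (subst reflect_cyclotomic) auto
    then have "of_int (c (2 * m - i)) = (of_int (c 0 * c i) :: complex)"
      using that by (simp add: coeff_reflect_poly degree_cyclotomic m c)
    then have "c (2 * m - i) = c 0 * c i"
      by (simp only: of_int_eq_iff)
    then show ?thesis
      using unit by auto
  qed
  have "poly (cyclotomic n) 1 = of_int (\<Sum>i\<le>2 * m. c i)"
    by (simp add: poly_altdef degree_cyclotomic m c)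
  then have "v = (\<Sum>i\<le>2 * m. c i)"
    using v by (simp only: of_int_eq_iff)
  \<comment> \<open>The sum is split at the middle index, and the upper half is folded onto the
    lower by \<open>i \<mapsto> 2 * m - i\<close>.\<close>
  also have "{..2 * m} = insert m ({..<m} \<union> {m<..2 * m})"
    by auto
  also have "(\<Sum>i\<in>insert m ({..<m} \<union> {m<..2 * m}). c i) =
      c m + ((\<Sum>i<m. c i) + (\<Sum>i\<in>{m<..2 * m}. c i))"
    by (subst sum.insert, auto, subst sum.union_disjoint, auto)
  also have "(\<Sum>i\<in>{m<..2 * m}. c i) = (\<Sum>i<m. c (2 * m - i))"
    by (intro sum.reindex_bij_witness[of _ "\<lambda>i. 2 * m - i" "\<lambda>i. 2 * m - i"]) auto
  also have "(\<Sum>i<m. c i) + \<dots> = (\<Sum>i<m. c i + c (2 * m - i))"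
    by (simp add: sum.distrib)
  finally have "v = c m + (\<Sum>i<m. c i + c (2 * m - i))" .
  moreover have "even (\<Sum>i<m. c i + c (2 * m - i))"
    by (intro dvd_sum) (simp add: sym)
  ultimately show ?thesis
    by (simp add: m_def)
qed

section \<open>Quotients of x^n - 1 and values at 1\<close>

text \<open>With y = x^k this is the geometric sum (y^m - 1) / (y - 1): the divisors of
  \<open>k\<close> contribute exactly y - 1, which is nonzero and cancels.\<close>

lemma prod_cyclotomic_quotient:
  assumes "k > 0" "m > 0"
  shows "(\<Prod>d | d dvd k * m \<and> \<not> d dvd k. cyclotomic d) = (\<Sum>i<m. monom 1 (k * i))"
proof -
  let ?q = "\<Prod>d | d dvd k * m \<and> \<not> d dvd k. cyclotomic d"
  have "{d. d dvd k * m} = {d. d dvd k} \<union> {d. d dvd k * m \<and> \<not> d dvd k}"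
    by auto
  then have "(\<Prod>d | d dvd k * m. cyclotomic d) = (\<Prod>d | d dvd k. cyclotomic d) * ?q"
    using assms by (simp only:) (intro prod.union_disjoint, auto)
  then have "(monom 1 k - 1) * ?q = monom 1 k ^ m - 1"
    using assms by (simp add: prod_cyclotomic monom_power)
  also have "\<dots> = (monom 1 k - 1) * (\<Sum>i<m. monom 1 k ^ i)"
    by (rule power_diff_1_eq)
  finally have "(monom 1 k - 1) * ?q = (monom 1 k - 1) * (\<Sum>i<m. monom 1 (k * i))"
    by (simp add: monom_power)
  moreover have "monom (1 :: complex) k - 1 \<noteq> 0"
    using assms by (simp add: monom_eq_1_iff)
  ultimately show ?thesis
    by simp
qed

text \<open>The quotient for \<open>m = 2\<close> has a single factor, since only
  \<open>2 ^ Suc a\<close> itself divides \<open>2 ^ Suc a\<close> without dividing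
  \<open>2 ^ a\<close>.\<close>

lemma cyclotomic_power_2: "cyclotomic (2 ^ Suc a) = monom 1 (2 ^ a) + 1"
proof -
  have "{d. d dvd 2 ^ a * 2 \<and> \<not> d dvd 2 ^ a} = {2 ^ Suc a :: nat}"
  proof (intro equalityI subsetI)
    fix d :: nat
    assume d: "d \<in> {d. d dvd 2 ^ a * 2 \<and> \<not> d dvd 2 ^ a}"
    then have "d dvd 2 ^ Suc a"
      by (simp add: mult.commute)
    then obtain b where b: "b \<le> Suc a" "d = 2 ^ b"
      using divides_primepow_nat[OF two_is_prime_nat] by blast
    with d have "\<not> b \<le> a"
      using le_imp_power_dvd by blast
    with b show "d \<in> {2 ^ Suc a}"
      by (simp add: le_Suc_eq)
  qed (auto dest: dvd_imp_le)
  then show ?thesis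
    using prod_cyclotomic_quotient[of "2 ^ a" 2]
    by (simp add: numeral_2_eq_2 monom_0 one_pCons add.commute)
qed

lemma odd_poly_cyclotomic_1:
  assumes "n > 0" "\<nexists>a. n = 2 ^ a"
  obtains v :: int where "odd v" "poly (cyclotomic n) 1 = of_int v"
proof -
  obtain a m where nm: "n = 2 ^ a * m" "odd m"
    by (rule multiplicity_decompose'[of n 2]) (use assms(1) in auto)
  \<comment> \<open>All factors take integer values at 1, so the product formula evaluated there
    becomes a divisibility among integers.\<close>
  have "\<exists>v :: int. poly (cyclotomic d) 1 = of_int v" for d
  proof -
    obtain c where "\<And>i. coeff (cyclotomic d) i = of_int (c i)"
      using cyclotomic_int_coeffs[of d] by blast
    then show ?thesis
      by (intro exI[of _ "\<Sum>i\<le>totient d. c i"]) (simp add: poly_altdef degree_cyclotomic)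
  qed
  then obtain v :: "nat \<Rightarrow> int" where v: "\<And>d. poly (cyclotomic d) 1 = of_int (v d)"
    by metis
  let ?D = "{d. d dvd n \<and> \<not> d dvd 2 ^ a}"
  have "(\<Prod>d\<in>?D. cyclotomic d) = (\<Sum>i<m. monom 1 (2 ^ a * i))"
    using prod_cyclotomic_quotient[of "2 ^ a" m] nm by (auto intro: odd_pos)
  then have "poly (\<Prod>d\<in>?D. cyclotomic d) 1 = of_int (int m)"
    by (simp add: poly_sum poly_monom)
  then have "of_int (\<Prod>d\<in>?D. v d) = (of_int (int m) :: complex)"
    by (simp add: poly_prod v)
  then have "(\<Prod>d\<in>?D. v d) = int m"
    by (simp only: of_int_eq_iff)
  \<comment> \<open>Divisors of \<open>2 ^ a\<close> are powers of 2, which \<open>n\<close> is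
    not.\<close>
  moreover have "n \<in> ?D"
  proof -
    have "\<not> n dvd 2 ^ a"
      using assms(2) divides_primepow_nat[OF two_is_prime_nat] by blast
    then show ?thesis
      by simp
  qed
  moreover have "finite ?D"
    using assms(1) by simp
  ultimately have "v n dvd int m"
    by (metis (no_types, lifting) dvd_prodI)
  moreover have "odd (int m)"
    using nm(2) by simp
  ultimately have "odd (v n)"
    by (meson dvd_trans)
  then show ?thesis
    using v[of n] by (rule that)
qed

section \<open>The two cases for n\<close>

theorem theorem1:
  fixes n :: nat
  assumes "n \<ge> 3"
  shows "degree (cyclotomic n) = totient n \<and> even (totient n) \<and>
    ((\<exists>m::nat. n = 2 ^ m) \<longrightarrow> coeff (cyclotomic n) (totient n div 2) = 0) \<and>
    ((\<nexists>m::nat. n = 2 ^ m) \<longrightarrow>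
      (\<exists>c::int. odd c \<and> coeff (cyclotomic n) (totient n div 2) = of_int c))"
proof (intro conjI impI)
  show "degree (cyclotomic n) = totient n"
    by (rule degree_cyclotomic)
  show "even (totient n)"
    using assms by (rule even_totient)
next
  assume "\<exists>m. n = 2 ^ m"
  then obtain m where m: "n = 2 ^ m"
    by blast
  have "m \<noteq> 0" "m \<noteq> 1"
    using assms m by (intro notI, simp)+
  then obtain a where "m = Suc (Suc a)"
    by (metis One_nat_def not0_implies_Suc)
  then have n: "n = 2 ^ Suc (Suc a)"
    by (simp add: m)
  \<comment> \<open>Here \<open>totient n = 2 ^ Suc a\<close>, so the middle exponent lies strictly
    between the only two exponents, 0 and \<open>2 ^ Suc a\<close>, that occur in
    \<open>cyclotomic n\<close>.\<close>
  have "totient n div 2 = 2 ^ a"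
    unfolding n by (subst totient_prime_power_Suc) auto
  then show "coeff (cyclotomic n) (totient n div 2) = 0"
    unfolding n cyclotomic_power_2 by (simp add: coeff_1)
next
  assume *: "\<nexists>m. n = 2 ^ m"
  obtain c where c: "\<And>i. coeff (cyclotomic n) i = of_int (c i)"
    using cyclotomic_int_coeffs[of n] by blast
  obtain v where "odd v" "poly (cyclotomic n) 1 = of_int v"
    using odd_poly_cyclotomic_1[of n] * assms by auto
  then have "odd (c (totient n div 2))"
    using odd_middle_coeff_cyclotomic_iff[OF assms c] by blast
  with c show "\<exists>c. odd c \<and> coeff (cyclotomic n) (totient n div 2) = of_int c"
    by blast
qed

end
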